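(* If $G$ is a nice graph with a vertex $u$ such that $d(u) \geq 2$, $N(u)$ is a stable set, and $\mathrm{ch}_\Pi^*(G-u) \leq \Delta(G-u)+3$, then $\mathrm{ch}_\Pi^*(G) \leq \Delta(G-u)+3$.
   Context: Graphs are finite and simple. A graph is nice if it has no connected component isomorphic to $K_2$. $d(u)$ is the degree of $u$, $N(u)$ its set of neighbours, $\Delta(H)$ is the maximum degree of a graph $H$, and $G-u$ is the graph obtained from $G$ by deleting $u$. A stable set is a set of pairwise non-adjacent vertices. A $k$-list assignment $L$ of $G$ assigns to every edge $e \in E(G)$ a set $L(e)$ of $k$ real numbers. An $L$-labelling is a map $\ell$ on $E(G)$ with $\ell(e) \in L(e)$ for every edge $e$. For a vertex $v$, set $\pi_\ell(v)=\prod_{w \in N(v)} \ell(vw)$ (with the empty product equal to $1$). The labelling $\ell$ is p-proper if $\pi_\ell(u) \neq \pi_\ell(v)$ for every edge $uv$. $\mathrm{ch}_\Pi^*(G)$ is the smallest $k \geq 1$, if any, such that $G$ admits a p-proper $L$-labelling for every $k$-list assignment $L$ with $0 \notin L(e)$ for every edge $e$; an inequality $\mathrm{ch}_\Pi^*(H) \leq k$ includes the assertion that such an integer exists for $H$. *)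

theory Defs
  imports Complex_Main "HOL-Library.Extended_Nat"
begin

text \<open>Undirected graphs are pairs of a vertex set and a set of two-element sets of vertices.\<close>

type_synonym 'a ugraph = "'a set \<times> 'a set set"

abbreviation verts :: "'a ugraph \<Rightarrow> 'a set" where
  "verts G \<equiv> fst G"

abbreviation edges :: "'a ugraph \<Rightarrow> 'a set set" where
  "edges G \<equiv> snd G"

definition finite_simple_graph :: "'a ugraph \<Rightarrow> bool" where
  "finite_simple_graph G \<longleftrightarrow>
     finite (verts G) \<and> (\<forall>e\<in>edges G. e \<subseteq> verts G \<and> card e = 2)"

definition adj :: "'a ugraph \<Rightarrow> 'a \<Rightarrow> 'a \<Rightarrow> bool" where
  "adj G u v \<longleftrightarrow> {u, v} \<in> edges G"

definition neighbours :: "'a ugraph \<Rightarrow> 'a \<Rightarrow> 'a set" where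
  "neighbours G u = {v \<in> verts G. adj G u v}"

definition vertex_degree :: "'a ugraph \<Rightarrow> 'a \<Rightarrow> nat" where
  "vertex_degree G u = card (neighbours G u)"

text \<open>Inserting 0 only matters for the graph without vertices, whose maximum degree is then 0.\<close>

definition max_degree :: "'a ugraph \<Rightarrow> nat" where
  "max_degree G = Max (insert 0 (vertex_degree G ` verts G))"

definition delete_vertex :: "'a ugraph \<Rightarrow> 'a \<Rightarrow> 'a ugraph" where
  "delete_vertex G u = (verts G - {u}, {e \<in> edges G. u \<notin> e})"

definition stable_set :: "'a ugraph \<Rightarrow> 'a set \<Rightarrow> bool" where
  "stable_set G S \<longleftrightarrow> S \<subseteq> verts G \<and> (\<forall>u\<in>S. \<forall>v\<in>S. \<not> adj G u v)"

definition induced_subgraph :: "'a ugraph \<Rightarrow> 'a set \<Rightarrow> 'a ugraph" where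
  "induced_subgraph G S = (verts G \<inter> S, {e \<in> edges G. e \<subseteq> S})"

definition connected_components :: "'a ugraph \<Rightarrow> 'a ugraph set" where
  "connected_components G =
     (\<lambda>v. induced_subgraph G {w. (adj G)\<^sup>*\<^sup>* v w}) ` verts G"

definition isomorphic :: "'a ugraph \<Rightarrow> 'b ugraph \<Rightarrow> bool" where
  "isomorphic G H \<longleftrightarrow>
     (\<exists>f. bij_betw f (verts G) (verts H) \<and>
          (\<forall>u\<in>verts G. \<forall>v\<in>verts G. adj G u v \<longleftrightarrow> adj H (f u) (f v)))"

definition complete_graph :: "nat \<Rightarrow> nat ugraph" where
  "complete_graph n = ({..<n}, {e. e \<subseteq> {..<n} \<and> card e = 2})"

definition nice :: "'a ugraph \<Rightarrow> bool" where
  "nice G \<longleftrightarrow> (\<forall>C\<in>connected_components G. \<not> isomorphic C (complete_graph 2))"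

definition list_assignment :: "nat \<Rightarrow> 'a ugraph \<Rightarrow> ('a set \<Rightarrow> real set) \<Rightarrow> bool" where
  "list_assignment k G L \<longleftrightarrow> (\<forall>e\<in>edges G. finite (L e) \<and> card (L e) = k)"

definition list_labelling :: "'a ugraph \<Rightarrow> ('a set \<Rightarrow> real set) \<Rightarrow> ('a set \<Rightarrow> real) \<Rightarrow> bool" where
  "list_labelling G L l \<longleftrightarrow> (\<forall>e\<in>edges G. l e \<in> L e)"

definition vertex_product :: "'a ugraph \<Rightarrow> ('a set \<Rightarrow> real) \<Rightarrow> 'a \<Rightarrow> real" where
  "vertex_product G l v = (\<Prod>w\<in>neighbours G v. l {v, w})"

definition p_proper :: "'a ugraph \<Rightarrow> ('a set \<Rightarrow> real) \<Rightarrow> bool" where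
  "p_proper G l \<longleftrightarrow> (\<forall>u v. {u, v} \<in> edges G \<longrightarrow> vertex_product G l u \<noteq> vertex_product G l v)"

definition product_choosable :: "'a ugraph \<Rightarrow> nat \<Rightarrow> bool" where
  "product_choosable G k \<longleftrightarrow>
     (\<forall>L. list_assignment k G L \<and> (\<forall>e\<in>edges G. 0 \<notin> L e) \<longrightarrow>
          (\<exists>l. list_labelling G L l \<and> p_proper G l))"

text \<open>
  The infimum of the empty set in \<^typ>\<open>enat\<close> is \<open>\<infinity>\<close>, so a finite upper bound on
  \<open>ch_prod_star G\<close> includes the existence of a suitable list size.
\<close>

definition ch_prod_star :: "'a ugraph \<Rightarrow> enat" where
  "ch_prod_star G = Inf {enat k | k. k \<ge> 1 \<and> product_choosable G k}"

end

(*
  Label G - u first, with lists of size k = Delta(G - u) + 3. At a neighbour v of u, the conditions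
  along the edges of G - u at v exclude at most Delta(G - u) labels of the edge uv, so a set of at
  least three labels remains, two of which have distinct absolute values. As N(u) is stable, these
  choices are independent, and what is left are the conditions at the edges uv: the product of the
  labels of the other edges at u must avoid a given number p(v). After taking logarithms, one has to
  find for given weights w > 0 and numbers c a subset X of A = N(u) such that the sum of w over
  X - {i} differs from c(i) for every i in A. This is the Combinatorial Nullstellensatz for
  the product over i of (sum of x(j) over j in A - {i}, minus c(i)): its multilinear coefficient is
  the number of derangements of A, which is positive as soon as A has two elements.
*)
theory Submission
  imports Defs "HOL-Library.FuncSet"
begin

section \<open>Choosing one element from each list at a vertex\<close>

text \<open>If some element of \<open>A\<close> lies outside \<open>S\<close>, toggling it pairs
  supersets of even and odd size, so everything cancels. This sieve later isolates the terms in
  which every variable occurs.\<close>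

lemma sum_alternating_supersets:
  assumes "finite A" "S \<subseteq> A"
  shows "(\<Sum>X | X \<in> Pow A \<and> S \<subseteq> X. (-1) ^ card X) =
           (if S = A then (-1) ^ card A else (0::'b::ring_1))"
proof (cases "S = A")
  case True
  then have "{X. X \<in> Pow A \<and> S \<subseteq> X} = {A}" by auto
  then show ?thesis using True by simp
next
  case False
  then have "S \<subset> A" using assms by auto
  from card_subsupersets_even_odd[OF assms(1) this]
  have "(\<Sum>X | X \<in> Pow A \<and> S \<subseteq> X. (-1) ^ card X) = (0::'b)"
    using assms by (intro sum_alternating_cancels) auto
  then show ?thesis using False by simp
qed

text \<open>Enumerate \<open>A\<close> and shift cyclically; with at least two elements the shift
  moves every point. This gives one derangement, enough for a positive coefficient.\<close>

lemma ex_fixpoint_free_surj: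
  assumes "finite A" "card A \<ge> 2"
  obtains f where "f ` A = A" "\<And>x. x \<in> A \<Longrightarrow> f x \<noteq> x"
proof -
  define n where "n = card A"
  obtain h where h: "bij_betw h {0..<n} A"
    using ex_bij_betw_nat_finite[OF assms(1)] n_def by blast
  define s where "s k = Suc k mod n" for k
  have n: "n \<ge> 2" using assms n_def by simp
  have s_less: "s k < n" for k using n by (simp add: s_def)
  have s_neq: "s k \<noteq> k" if "k < n" for k
    using that n by (cases "Suc k = n") (auto simp: s_def)
  have s_surj: "\<exists>k<n. s k = j" if "j < n" for j
  proof (cases j)
    case 0
    then show ?thesis using n by (intro exI[of _ "n - 1"]) (auto simp: s_def)
  next
    case (Suc m)
    then show ?thesis using that by (intro exI[of _ m]) (auto simp: s_def)
  qed
  define f where "f x = h (s (the_inv_into {0..<n} h x))" for x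
  have inj: "inj_on h {0..<n}" and im: "h ` {0..<n} = A"
    using h by (auto simp: bij_betw_def)
  have fh: "f (h k) = h (s k)" if "k < n" for k
    using that inj by (simp add: f_def the_inv_into_f_f)
  have "s ` {0..<n} = {0..<n}"
  proof (rule antisym)
    show "s ` {0..<n} \<subseteq> {0..<n}" using s_less by auto
    show "{0..<n} \<subseteq> s ` {0..<n}"
    proof
      fix j assume "j \<in> {0..<n}"
      then obtain k where "k < n" "s k = j" using s_surj by auto
      then show "j \<in> s ` {0..<n}" by auto
    qed
  qed
  moreover have "f ` h ` {0..<n} = h ` s ` {0..<n}"
    by (simp add: image_image fh)
  ultimately have "f ` A = A" using im by simp
  moreover have "f x \<noteq> x" if "x \<in> A" for x
  proof -
    have "x \<in> h ` {0..<n}" using that im by simp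
    then obtain k where k: "k < n" "x = h k" by auto
    have "h (s k) \<noteq> h k"
      using inj_on_eq_iff[OF inj, of "s k" k] s_less[of k] s_neq[of k] k(1) by simp
    then show ?thesis using fh k by simp
  qed
  ultimately show ?thesis using that by blast
qed

text \<open>The coefficient argument is done by hand: if every \<open>X\<close> failed, the product
  over \<open>i\<close> would vanish at the indicator vector of every \<open>X\<close>, and so would
  its alternating sum over \<open>X\<close>. Up to sign, that sum is the coefficient of the monomial
  containing all variables.\<close>

lemma ex_subset_sums_avoid:
  fixes w c :: "'i \<Rightarrow> real"
  assumes fin: "finite A" and card: "card A \<ge> 2" and w: "\<And>j. j \<in> A \<Longrightarrow> w j > 0"
  shows "\<exists>X\<subseteq>A. \<forall>i\<in>A. sum w (X - {i}) \<noteq> c i"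
proof (rule ccontr)
  assume contra: "\<not> ?thesis"
  \<comment> \<open>Coefficients of the \<open>i\<close>-th linear factor: \<open>None\<close> marks
    the constant term, \<open>Some j\<close> the variable of \<open>j\<close>, with 0 on the
    diagonal because \<open>i\<close> is removed from \<open>X\<close>. \<open>B X\<close> lists the
    terms alive at the indicator vector of \<open>X\<close>, and \<open>S g\<close> is the set of
    variables picked by the choice \<open>g\<close>.\<close>
  define m where "m i y = (case y of None \<Rightarrow> - c i | Some j \<Rightarrow> if j = i then 0 else w j)" for i y
  define B where "B X = insert None (Some ` X)" for X :: "'i set"
  define S where "S g = {j. Some j \<in> g ` A}" for g :: "'i \<Rightarrow> 'i option"
  have fin_PiE: "finite (PiE A (\<lambda>_. B X))" if "X \<subseteq> A" for X
    using that fin by (intro finite_PiE) (auto simp: B_def finite_subset)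
  have sum_m: "(\<Sum>y\<in>B X. m i y) = sum w (X - {i}) - c i" if "X \<subseteq> A" for X i
  proof -
    have "finite X" using that fin finite_subset by blast
    moreover from this have "(\<Sum>j\<in>X. if j = i then 0 else w j) = sum w (X - {i})"
      by (intro sum.mono_neutral_cong_right) auto
    ultimately show ?thesis by (simp add: B_def m_def sum.reindex)
  qed
  \<comment> \<open>Expressing the dependence on \<open>X\<close> as the condition
    \<open>S g \<subseteq> X\<close> on choices from the fixed \<open>B A\<close> allows the sums
    over \<open>X\<close> and \<open>g\<close> to be exchanged.\<close>
  have PiE_B: "{g \<in> PiE A (\<lambda>_. B A). S g \<subseteq> X} = PiE A (\<lambda>_. B X)" if "X \<subseteq> A" for X
  proof (intro set_eqI iffI)
    fix g assume g: "g \<in> {g \<in> PiE A (\<lambda>_. B A). S g \<subseteq> X}"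
    have "g x \<in> B X" if "x \<in> A" for x
    proof (cases "g x")
      case (Some j)
      then have "j \<in> S g" using that by (force simp: S_def)
      then show ?thesis using g Some by (auto simp: B_def)
    qed (simp add: B_def)
    then show "g \<in> PiE A (\<lambda>_. B X)" using g by (auto simp: PiE_iff)
  next
    fix g assume g: "g \<in> PiE A (\<lambda>_. B X)"
    have "S g \<subseteq> X"
    proof
      fix j assume "j \<in> S g"
      then obtain x where "x \<in> A" "g x = Some j" by (auto simp: S_def image_iff)
      then show "j \<in> X" using PiE_mem[OF g, of x] by (auto simp: B_def)
    qed
    moreover have "g \<in> PiE A (\<lambda>_. B A)"
      using g that by (auto simp: PiE_iff B_def)
    ultimately show "g \<in> {g \<in> PiE A (\<lambda>_. B A). S g \<subseteq> X}" by simp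
  qed
  have "0 = (\<Sum>X\<in>Pow A. (-1) ^ card X * (\<Prod>i\<in>A. \<Sum>y\<in>B X. m i y))"
  proof (rule sum.neutral[symmetric], rule ballI)
    fix X assume X: "X \<in> Pow A"
    then obtain i where "i \<in> A" "sum w (X - {i}) = c i" using contra by auto
    then have "(\<Prod>i\<in>A. \<Sum>y\<in>B X. m i y) = 0"
      using X sum_m fin by (intro prod_zero) auto
    then show "(-1) ^ card X * (\<Prod>i\<in>A. \<Sum>y\<in>B X. m i y) = 0" by simp
  qed
  also have "\<dots> = (\<Sum>X\<in>Pow A. \<Sum>g | g \<in> PiE A (\<lambda>_. B A) \<and> S g \<subseteq> X.
                     (-1) ^ card X * (\<Prod>i\<in>A. m i (g i)))"
  proof (rule sum.cong[OF refl])
    fix X assume X: "X \<in> Pow A"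
    then have "finite (B X)" using fin by (auto simp: B_def finite_subset)
    then have "(\<Prod>i\<in>A. \<Sum>y\<in>B X. m i y) = (\<Sum>g\<in>PiE A (\<lambda>_. B X). \<Prod>i\<in>A. m i (g i))"
      using fin by (intro prod_sum_PiE) auto
    then show "(-1) ^ card X * (\<Prod>i\<in>A. \<Sum>y\<in>B X. m i y) =
      (\<Sum>g | g \<in> PiE A (\<lambda>_. B A) \<and> S g \<subseteq> X. (-1) ^ card X * (\<Prod>i\<in>A. m i (g i)))"
      using X by (simp add: PiE_B sum_distrib_left)
  qed
  also have "\<dots> = (\<Sum>g\<in>PiE A (\<lambda>_. B A). \<Sum>X | X \<in> Pow A \<and> S g \<subseteq> X.
                     (-1) ^ card X * (\<Prod>i\<in>A. m i (g i)))"
    using fin fin_PiE by (intro sum.swap_restrict) auto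
  \<comment> \<open>For fixed \<open>g\<close>, the signs of the sets \<open>X\<close> above
    \<open>S g\<close> cancel unless \<open>S g = A\<close>.\<close>
  also have "\<dots> = (\<Sum>g\<in>PiE A (\<lambda>_. B A).
                     (-1) ^ card A * (if S g = A then \<Prod>i\<in>A. m i (g i) else 0))"
  proof (rule sum.cong[OF refl])
    fix g assume "g \<in> PiE A (\<lambda>_. B A)"
    then have "S g \<subseteq> A" using PiE_B[of A] by auto
    from sum_alternating_supersets[OF fin this, where ?'b = real]
    show "(\<Sum>X | X \<in> Pow A \<and> S g \<subseteq> X. (-1) ^ card X * (\<Prod>i\<in>A. m i (g i))) =
      (-1) ^ card A * (if S g = A then \<Prod>i\<in>A. m i (g i) else 0)"
      by (simp add: sum_distrib_right[symmetric])
  qed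
  finally have zero:
    "(\<Sum>g\<in>PiE A (\<lambda>_. B A). if S g = A then \<Prod>i\<in>A. m i (g i) else 0) = 0"
    by (simp add: sum_distrib_left[symmetric])
  have nonneg: "0 \<le> (if S g = A then \<Prod>i\<in>A. m i (g i) else 0)" for g
  proof (cases "S g = A")
    case True
    \<comment> \<open>\<open>g\<close> takes at most \<open>card A\<close> values and must already
      cover \<open>Some\<close> followed by each element of \<open>A\<close>, so \<open>None\<close>
      never occurs. Thus the constants \<open>c i\<close>, whose sign is unknown, drop out, and only
      zeros and weights are multiplied.\<close>
    then have sub: "Some ` A \<subseteq> g ` A" by (auto simp: S_def)
    moreover have "card (g ` A) \<le> card (Some ` A)"
      using card_image_le[OF fin] by (simp add: card_image)
    ultimately have "Some ` A = g ` A" using fin by (intro card_seteq) auto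
    then have "0 \<le> m i (g i)" if "i \<in> A" for i
    proof -
      have "g i \<in> Some ` A" using that \<open>Some ` A = g ` A\<close> by simp
      then obtain j where "g i = Some j" "j \<in> A" by blast
      then show ?thesis using w[of j] by (simp add: m_def)
    qed
    then show ?thesis by (simp add: prod_nonneg)
  qed auto
  obtain f where f: "f ` A = A" "\<And>x. x \<in> A \<Longrightarrow> f x \<noteq> x"
    by (rule ex_fixpoint_free_surj[OF fin card]) blast
  define g where "g = restrict (Some \<circ> f) A"
  have "g \<in> PiE A (\<lambda>_. B A)" using f(1) by (auto simp: g_def B_def PiE_iff)
  moreover have "S g = A" using f(1) by (force simp: g_def S_def)
  moreover have "(\<Prod>i\<in>A. m i (g i)) > 0"
    using f w by (intro prod_pos) (auto simp: g_def m_def)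
  ultimately have "(\<Sum>g\<in>PiE A (\<lambda>_. B A). if S g = A then \<Prod>i\<in>A. m i (g i) else 0) > 0"
    using fin_PiE[of A] nonneg by (intro sum_pos2[of _ g]) auto
  then show False using zero by simp
qed

text \<open>A real number shares its absolute value only with its negative. This is why three
  remaining labels are required although only two will be used.\<close>

lemma ex_two_distinct_abs:
  fixes B :: "real set"
  assumes "card B \<ge> 3"
  shows "\<exists>x\<in>B. \<exists>y\<in>B. \<bar>x\<bar> < \<bar>y\<bar>"
proof (rule ccontr)
  assume contra: "\<not> ?thesis"
  obtain x where "x \<in> B" using assms by fastforce
  then have "\<bar>z\<bar> = \<bar>x\<bar>" if "z \<in> B" for z using contra that by (meson antisym not_less)
  then have "B \<subseteq> {x, - x}" by (auto simp: abs_eq_iff)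
  then have "card B \<le> card {x, - x}" by (intro card_mono) auto
  also have "\<dots> \<le> 2" by (simp add: card_insert_if)
  finally show False using assms by simp
qed

text \<open>It suffices to avoid equality of the logarithms of absolute values, so signs can be
  ignored. Keeping two labels of distinct absolute value per list turns a choice into a subset
  \<open>X\<close>.\<close>

lemma ex_choice_partial_products_avoid:
  fixes B :: "'i \<Rightarrow> real set" and p :: "'i \<Rightarrow> real"
  assumes fin: "finite A" and card: "card A \<ge> 2"
    and B: "\<And>i. i \<in> A \<Longrightarrow> card (B i) \<ge> 3" and nz: "\<And>i. i \<in> A \<Longrightarrow> 0 \<notin> B i"
  shows "\<exists>a. \<forall>i\<in>A. a i \<in> B i \<and> prod a (A - {i}) \<noteq> p i"
proof -
  have "\<forall>i\<in>A. \<exists>x y. x \<in> B i \<and> y \<in> B i \<and> \<bar>x\<bar> < \<bar>y\<bar>"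
    using ex_two_distinct_abs B by blast
  then obtain x y where xy: "\<And>i. i \<in> A \<Longrightarrow> x i \<in> B i \<and> y i \<in> B i \<and> \<bar>x i\<bar> < \<bar>y i\<bar>"
    by metis
  \<comment> \<open>The gain in logarithm on replacing the smaller label by the larger. The
    contribution of the smaller labels is moved into \<open>c\<close> below.\<close>
  define w where "w i = ln \<bar>y i\<bar> - ln \<bar>x i\<bar>" for i
  have "w i > 0" if "i \<in> A" for i
  proof -
    have "x i \<noteq> 0" using xy nz that by metis
    then show ?thesis using xy[OF that] by (auto simp: w_def)
  qed
  from ex_subset_sums_avoid[where w = w and c = "\<lambda>i. ln \<bar>p i\<bar> - (\<Sum>j\<in>A - {i}. ln \<bar>x j\<bar>)",
      OF fin card this]
  obtain X where X: "X \<subseteq> A"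
    "\<And>i. i \<in> A \<Longrightarrow> sum w (X - {i}) \<noteq> ln \<bar>p i\<bar> - (\<Sum>j\<in>A - {i}. ln \<bar>x j\<bar>)"
    by auto
  define a where "a i = (if i \<in> X then y i else x i)" for i
  have aB: "a i \<in> B i" if "i \<in> A" for i using xy that by (simp add: a_def)
  have "prod a (A - {i}) \<noteq> p i" if i: "i \<in> A" for i
  proof
    assume "prod a (A - {i}) = p i"
    then have "ln \<bar>p i\<bar> = ln (\<Prod>j\<in>A - {i}. \<bar>a j\<bar>)" by (simp add: abs_prod[symmetric])
    also have "\<dots> = (\<Sum>j\<in>A - {i}. ln \<bar>a j\<bar>)"
      using fin aB nz by (intro ln_prod) (auto, metis)
    also have "\<dots> = (\<Sum>j\<in>A - {i}. ln \<bar>x j\<bar> + (if j \<in> X then w j else 0))"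
      by (intro sum.cong) (auto simp: a_def w_def)
    also have "\<dots> = (\<Sum>j\<in>A - {i}. ln \<bar>x j\<bar>) + sum w (X - {i})"
    proof -
      have "(\<Sum>j\<in>A - {i}. if j \<in> X then w j else 0) = sum w (X - {i})"
        using fin X(1) by (intro sum.mono_neutral_cong_right) auto
      then show ?thesis by (simp add: sum.distrib)
    qed
    finally show False using X(2)[OF i] by simp
  qed
  then show ?thesis using aB by blast
qed

section \<open>Deleting a vertex\<close>

text \<open>Shrink every list to \<open>j\<close> of its elements and label from the smaller
  lists.\<close>

lemma product_choosable_mono:
  assumes "product_choosable G j" "j \<le> k"
  shows "product_choosable G k"
  unfolding product_choosable_def
proof (intro allI impI)
  fix L assume L: "list_assignment k G L \<and> (\<forall>e\<in>edges G. 0 \<notin> L e)"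
  have "\<exists>M. M \<subseteq> L e \<and> finite M \<and> card M = j" if "e \<in> edges G" for e
    using L that assms(2) obtain_subset_with_card_n[of j "L e"]
    by (metis finite_subset list_assignment_def)
  then obtain M where M: "\<And>e. e \<in> edges G \<Longrightarrow> M e \<subseteq> L e \<and> finite (M e) \<and> card (M e) = j"
    by metis
  then have "list_assignment j G M \<and> (\<forall>e\<in>edges G. 0 \<notin> M e)"
    using L by (fastforce simp: list_assignment_def)
  then obtain l where "list_labelling G M l" "p_proper G l"
    using assms(1) by (auto simp: product_choosable_def)
  then show "\<exists>l. list_labelling G L l \<and> p_proper G l"
    using M unfolding list_labelling_def by blast
qed

text \<open>A nonempty set of extended naturals contains its infimum, so a finite bound yields an
  actual list size, which monotonicity raises to \<open>k\<close>.\<close>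

lemma ch_prod_star_le_iff:
  assumes "k \<ge> 1"
  shows "ch_prod_star G \<le> enat k \<longleftrightarrow> product_choosable G k"
proof
  assume le: "ch_prod_star G \<le> enat k"
  let ?K = "{enat j | j. j \<ge> 1 \<and> product_choosable G j}"
  have "?K \<noteq> {}" using le unfolding ch_prod_star_def by (auto simp: top_enat_def simp del: Collect_empty_eq)
  then have "ch_prod_star G \<in> ?K"
    unfolding ch_prod_star_def by (metis (no_types, lifting) Inf_enat_def LeastI ex_in_conv)
  then show "product_choosable G k" using le product_choosable_mono[of G _ k] by auto
next
  assume "product_choosable G k"
  then show "ch_prod_star G \<le> enat k"
    using assms unfolding ch_prod_star_def by (intro Inf_lower) auto
qed

lemma adj_sym: "adj G v w \<longleftrightarrow> adj G w v"
  by (simp add: adj_def insert_commute)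

lemma adj_imp_neq: "finite_simple_graph G \<Longrightarrow> adj G v w \<Longrightarrow> v \<noteq> w"
  by (auto simp: finite_simple_graph_def adj_def)

lemma adj_iff_neighbours:
  "finite_simple_graph G \<Longrightarrow> adj G v w \<longleftrightarrow> w \<in> neighbours G v"
  by (auto simp: finite_simple_graph_def adj_def neighbours_def)

lemma adj_delete_vertex: "v \<noteq> u \<Longrightarrow> w \<noteq> u \<Longrightarrow> adj (delete_vertex G u) v w \<longleftrightarrow> adj G v w"
  by (auto simp: adj_def delete_vertex_def)

lemma neighbours_delete_vertex:
  "v \<noteq> u \<Longrightarrow> neighbours (delete_vertex G u) v = neighbours G v - {u}"
  by (auto simp: adj_def delete_vertex_def neighbours_def)

lemma finite_neighbours: "finite_simple_graph G \<Longrightarrow> finite (neighbours G v)"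
  by (simp add: finite_simple_graph_def neighbours_def)

lemma vertex_degree_le_max_degree:
  "finite (verts G) \<Longrightarrow> v \<in> verts G \<Longrightarrow> vertex_degree G v \<le> max_degree G"
  by (auto simp: max_degree_def intro!: Max_ge)

lemma product_choosable_extend:
  assumes G: "finite_simple_graph G"
    and deg: "vertex_degree G u \<ge> 2"
    and stable: "stable_set G (neighbours G u)"
    and choosable: "product_choosable (delete_vertex G u) k"
    and k: "max_degree (delete_vertex G u) + 3 \<le> k"
  shows "product_choosable G k"
  unfolding product_choosable_def
proof (intro allI impI)
  fix L assume L: "list_assignment k G L \<and> (\<forall>e\<in>edges G. 0 \<notin> L e)"
  define H where "H = delete_vertex G u"
  define N where "N = neighbours G u"
  have finN: "finite N" using G by (simp add: N_def finite_neighbours)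
  have cardN: "card N \<ge> 2" using deg by (simp add: N_def vertex_degree_def)
  have N_iff: "v \<in> N \<longleftrightarrow> adj G u v" for v using G adj_iff_neighbours N_def by metis
  have N_neq: "v \<noteq> u" if "v \<in> N" for v using that N_iff adj_imp_neq[OF G] by blast
  have "list_assignment k H L \<and> (\<forall>e\<in>edges H. 0 \<notin> L e)"
    using L by (auto simp: H_def delete_vertex_def list_assignment_def)
  then obtain l0 where l0: "list_labelling H L l0" "p_proper H l0"
    using choosable by (auto simp: product_choosable_def H_def)
  \<comment> \<open>The product at \<open>v\<close> before the edges at \<open>u\<close> are
    labelled. It is nonzero as the lists avoid 0, so it can be divided by.\<close>
  define P where "P v = vertex_product H l0 v" for v
  have P_nz: "P v \<noteq> 0" for v
  proof -
    have "l0 {v, w} \<noteq> 0" if "w \<in> neighbours H v" for w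
      using that l0(1) L by (force simp: neighbours_def adj_def list_labelling_def H_def delete_vertex_def)
    moreover have "finite (neighbours H v)"
      using G by (simp add: neighbours_def H_def delete_vertex_def finite_simple_graph_def)
    ultimately show ?thesis by (simp add: P_def vertex_product_def)
  qed
  \<comment> \<open>A label \<open>P w / P v\<close> on \<open>uv\<close> would lift the product at
    \<open>v\<close> to exactly \<open>P w\<close>, the final product at its neighbour
    \<open>w\<close>, which stability keeps outside \<open>N\<close>.\<close>
  define B where "B v = L {u, v} - (\<lambda>w. P w / P v) ` neighbours H v" for v
  have B_card: "card (B v) \<ge> 3" if "v \<in> N" for v
  proof -
    have v: "v \<in> verts H"
      using that N_neq by (auto simp: N_def neighbours_def H_def delete_vertex_def)
    have finH: "finite (verts H)"
      using G by (simp add: H_def delete_vertex_def finite_simple_graph_def)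
    then have fin: "finite (neighbours H v)" by (simp add: neighbours_def)
    then have "card ((\<lambda>w. P w / P v) ` neighbours H v) \<le> vertex_degree H v"
      by (simp add: vertex_degree_def card_image_le)
    also have "\<dots> \<le> max_degree H" using finH v by (rule vertex_degree_le_max_degree)
    finally have "card ((\<lambda>w. P w / P v) ` neighbours H v) + 3 \<le> k" using k by (simp add: H_def)
    moreover have "card (L {u, v}) = k"
      using L that by (auto simp: N_iff adj_def list_assignment_def)
    moreover have "card (L {u, v}) - card ((\<lambda>w. P w / P v) ` neighbours H v) \<le> card (B v)"
      unfolding B_def using fin by (intro diff_card_le_card_Diff) auto
    ultimately show ?thesis by linarith
  qed
  have "0 \<notin> B v" if "v \<in> N" for v
    using L that by (auto simp: N_iff adj_def B_def)
  \<comment> \<open>Cancelling \<open>a v\<close> from \<open>prod a N = a v * P v\<close> leaves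
    \<open>prod a (N - {v}) = P v\<close>, hence the forbidden values \<open>P\<close>.\<close>
  from ex_choice_partial_products_avoid[where B = B and p = P, OF finN cardN B_card this]
  obtain a where a: "\<And>v. v \<in> N \<Longrightarrow> a v \<in> B v" "\<And>v. v \<in> N \<Longrightarrow> prod a (N - {v}) \<noteq> P v"
    by auto
  have a_nz: "a v \<noteq> 0" if "v \<in> N" for v
    using a(1)[OF that] L that by (auto simp: N_iff adj_def B_def)
  \<comment> \<open>For an edge at \<open>u\<close>, \<open>e - {u}\<close> is the singleton of the
    other end.\<close>
  define l where "l e = (if u \<in> e then a (the_elem (e - {u})) else l0 e)" for e
  have l_u: "l {u, v} = a v" if "v \<noteq> u" for v
  proof -
    have "{u, v} - {u} = {v}" using that by auto
    then show ?thesis by (simp add: l_def)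
  qed
  have prod_u: "vertex_product G l u = prod a N"
    unfolding vertex_product_def N_def[symmetric] using N_neq l_u by (intro prod.cong) auto
  have prod_H: "(\<Prod>w\<in>neighbours G v - {u}. l {v, w}) = P v" if "v \<noteq> u" for v
    unfolding P_def vertex_product_def H_def neighbours_delete_vertex[OF that]
    using that by (intro prod.cong) (auto simp: l_def)
  have prod_N: "vertex_product G l v = a v * P v" if "v \<in> N" for v
  proof -
    have "u \<in> neighbours G v" using that G N_iff adj_iff_neighbours adj_sym by metis
    then have "vertex_product G l v = l {v, u} * (\<Prod>w\<in>neighbours G v - {u}. l {v, w})"
      unfolding vertex_product_def using G by (intro prod.remove finite_neighbours)
    moreover have "l {v, u} = a v" using l_u[OF N_neq[OF that]] by (simp add: insert_commute)
    ultimately show ?thesis using prod_H[OF N_neq[OF that]] by simp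
  qed
  have prod_other: "vertex_product G l v = P v" if "v \<notin> N" "v \<noteq> u" for v
  proof -
    have "u \<notin> neighbours G v" using that G N_iff adj_iff_neighbours adj_sym by metis
    then show ?thesis using prod_H[OF that(2)] by (simp add: vertex_product_def)
  qed
  have proper_u: "vertex_product G l u \<noteq> vertex_product G l v" if "v \<in> N" for v
    using a(2)[OF that] a_nz[OF that] prod.remove[OF finN that, of a]
    by (simp add: prod_u prod_N[OF that])
  have proper_N: "vertex_product G l v \<noteq> vertex_product G l w"
    if "v \<in> N" "w \<noteq> u" "adj G v w" for v w
  proof -
    have "w \<notin> N" using that stable by (auto simp: stable_set_def N_def)
    have "w \<in> neighbours H v"
      using that N_neq G by (simp add: H_def neighbours_delete_vertex adj_iff_neighbours)
    then have "a v \<noteq> P w / P v" using a(1)[OF that(1)] by (auto simp: B_def)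
    then show ?thesis
      using P_nz[of v] \<open>w \<notin> N\<close> that by (simp add: prod_N prod_other field_simps)
  qed
  have "vertex_product G l v \<noteq> vertex_product G l w" if vw: "adj G v w" for v w
  proof -
    \<comment> \<open>Outside \<open>N\<close> and away from \<open>u\<close> the products are those
      of \<open>l0\<close>, so only edges meeting \<open>N\<close> or \<open>u\<close> need the new
      choices.\<close>
    consider "v = u" | "w = u" | "v \<in> N" "w \<noteq> u" | "w \<in> N" "v \<noteq> u"
      | "v \<notin> N" "w \<notin> N" "v \<noteq> u" "w \<noteq> u" by blast
    then show ?thesis
    proof cases
      case 1
      then show ?thesis using proper_u vw N_iff by blast
    next
      case 2
      then show ?thesis using proper_u[of v] vw N_iff adj_sym by metis
    next
      case 3
      then show ?thesis using proper_N vw by blast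
    next
      case 4
      then show ?thesis using proper_N[of w v] vw adj_sym by metis
    next
      case 5
      then have "adj H v w" using vw by (simp add: H_def adj_delete_vertex)
      then show ?thesis
        using l0(2) 5 by (simp add: prod_other P_def p_proper_def adj_def)
    qed
  qed
  then have "p_proper G l" by (simp add: p_proper_def adj_def)
  moreover have "list_labelling G L l"
    unfolding list_labelling_def
  proof
    fix e assume e: "e \<in> edges G"
    show "l e \<in> L e"
    proof (cases "u \<in> e")
      case True
      have "card e = 2" using G e by (simp add: finite_simple_graph_def)
      then obtain v where v: "e = {u, v}" using True by (auto simp: card_2_iff)
      then have "v \<in> N" using e by (simp add: N_iff adj_def)
      then show ?thesis using a(1) l_u N_neq v by (auto simp: B_def)
    next
      case False
      then show ?thesis
        using e l0(1) by (simp add: l_def list_labelling_def H_def delete_vertex_def)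
    qed
  qed
  ultimately show "\<exists>l. list_labelling G L l \<and> p_proper G l" by blast
qed

theorem theorem3p2:
  fixes G :: "'a ugraph" and u :: 'a
  assumes "finite_simple_graph G"
    and "nice G"
    and "u \<in> verts G"
    and "vertex_degree G u \<ge> 2"
    and "stable_set G (neighbours G u)"
    and "ch_prod_star (delete_vertex G u) \<le> enat (max_degree (delete_vertex G u) + 3)"
  shows "ch_prod_star G \<le> enat (max_degree (delete_vertex G u) + 3)"
proof -
  have k: "1 \<le> max_degree (delete_vertex G u) + 3" by simp
  show ?thesis
    using product_choosable_extend[OF assms(1,4,5) _ order.refl] assms(6)
    unfolding ch_prod_star_le_iff[OF k] by blast
qed

end
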